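(* Given any $\epsilon>0$ there exists a set $A\subset\mathbb{N}$ with $\mathrm{d}^*(A)>1-\epsilon$ such that for any sequence $(k_i)_{i\in\mathbb{N}}$ of natural numbers, any nested sequence $B_1\supset B_2\supset\cdots$ of infinite subsets of $\mathbb{N}$, and any sequence $(t_i)_{i\in\mathbb{N}}$ of natural numbers, it does not hold that $$\Big\{\sum_{n\in F}n \;:\; F\subset B_i\text{ with } k_i\leq|F|\leq k_i+i\Big\}\subset A-t_i\quad\text{for every } i\in\mathbb{N}.$$
   Context: $\mathbb{N}=\{1,2,3,\dots\}$. The upper Banach density of $A\subset\mathbb{N}$ is $\mathrm{d}^*(A)=\limsup_{N-M\to\infty}\frac{|A\cap\{M,M+1,\ldots,N-1\}|}{N-M}$. For an integer $t$, $A-t=\{a-t: a\in A\}$. *)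

theory Defs
  imports Complex_Main "HOL-Library.Extended_Real" "HOL-Library.Liminf_Limsup"
begin

text \<open>Here the natural numbers start at 1: subsets of them are sets \<open>A :: nat set\<close> with
  \<open>A \<subseteq> {1..}\<close>, and sequences indexed by them are functions on \<open>nat\<close> whose value at 0 is ignored.\<close>

text \<open>The filter of pairs \<open>(M, N)\<close> of positive integers with \<open>N - M \<rightarrow> \<infinity>\<close>; the difference is
  taken in \<open>int\<close>, so that pairs with \<open>N < M\<close> are eventually discarded.\<close>

definition long_windows :: "(nat \<times> nat) filter" where
  "long_windows =
     inf (filtercomap (\<lambda>(M, N). int N - int M) at_top) (principal ({1..} \<times> {1..}))"

definition upper_banach_density :: "nat set \<Rightarrow> ereal" where
  "upper_banach_density A =
     Limsup long_windows
       (\<lambda>(M, N). ereal (real (card (A \<inter> {M..<N})) / (real N - real M)))"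

text \<open>The translate \<open>A - t\<close> lives in the integers, so there is no truncated subtraction.\<close>

definition shift :: "nat set \<Rightarrow> int \<Rightarrow> int set" where
  "shift A t = {int a - t |a. a \<in> A}"

end

theory Submission
  imports Defs "HOL-Number_Theory.Cong" "HOL-Computational_Algebra.Primes"
begin

text \<open>Remove from the positive integers, for every \<open>a\<close>, all \<open>x \<ge> 2\<^sup>b\<close> whose residue modulo
  \<open>2\<^sup>b\<close> is less than \<open>2\<^sup>a\<close>, where \<open>b = 2 a + c\<close>. The removed set has density at most
  \<open>\<Sum>\<^sub>a 2\<^sup>a\<^sup>-\<^sup>b = 2\<^sup>1\<^sup>-\<^sup>c\<close>, which is small. Suppose \<open>B\<^sub>i\<close>, \<open>k\<^sub>i\<close>, \<open>t\<^sub>i\<close> were given. If \<open>B\<^sub>1\<close>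
  contains infinitely many multiples of every power of 2, then adding \<open>t\<^sub>1\<close> to a sum of \<open>k\<^sub>1\<close>
  multiples of a high power \<open>2\<^sup>b\<close> gives a number with the small residue \<open>t\<^sub>1\<close>. Otherwise some \<open>2\<^sup>m\<close>
  divides only finitely many elements of \<open>B\<^sub>1\<close>, hence of every \<open>B\<^sub>i\<close>. Take \<open>a = m\<close> and \<open>i = 2\<^sup>b\<close>;
  infinitely many elements of \<open>B\<^sub>i\<close> share a residue \<open>r\<close> modulo \<open>2\<^sup>b\<close> not divisible by \<open>2\<^sup>m\<close>, so
  among the sums of \<open>k\<^sub>i, \<dots>, k\<^sub>i + i\<close> of them every multiple of \<open>gcd r 2\<^sup>b < 2\<^sup>m\<close> modulo \<open>2\<^sup>b\<close>
  occurs, and some translate by \<open>t\<^sub>i\<close> has residue less than \<open>2\<^sup>m\<close>, however large \<open>t\<^sub>i\<close> is.\<close>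

definition dyadic_sieve :: "nat \<Rightarrow> nat set" where
  "dyadic_sieve c = {x. 1 \<le> x \<and> (\<forall>a. x < 2 ^ (2 * a + c) \<or> 2 ^ a \<le> x mod 2 ^ (2 * a + c))}"

text \<open>The pairs \<open>(1, N)\<close> run along \<open>long_windows\<close>, so every eventual
  property \<open>P\<close> holds at one of them. The bound at that single initial window already
  bounds the supremum over \<open>P\<close> from below.\<close>

lemma le_upper_banach_density:
  fixes l :: ereal
  assumes "\<And>n. n \<ge> 1 \<Longrightarrow> l \<le> ereal (real (card (A \<inter> {1..n})) / real n)"
  shows "l \<le> upper_banach_density A"
  unfolding upper_banach_density_def
proof (rule Limsup_greatest)
  fix P :: "nat \<times> nat \<Rightarrow> bool"
  assume P: "eventually P long_windows"
  have "filterlim (\<lambda>N. int N - 1) at_top sequentially"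
    unfolding filterlim_at_top eventually_sequentially
    by (metis add.commute le_diff_eq nat_le_iff)
  moreover have "\<forall>\<^sub>F N :: nat in sequentially. 1 \<le> N"
    by (rule eventually_ge_at_top)
  ultimately have "filterlim (\<lambda>N. (1, N)) long_windows sequentially"
    by (simp add: long_windows_def filterlim_inf filterlim_filtercomap_iff filterlim_principal
        comp_def)
  then have "\<forall>\<^sub>F N in sequentially. P (1, N)"
    using P by (simp add: filterlim_iff)
  then obtain N0 where "\<forall>N\<ge>N0. P (1, N)"
    by (auto simp: eventually_sequentially)
  \<comment> \<open>Adding 2 makes the window \<open>{1..<N0 + 2}\<close> nonempty, so the
    assumption applies with \<open>n = N0 + 1\<close>.\<close>
  then have PN: "P (1, N0 + 2)" by simp
  have "l \<le> ereal (real (card (A \<inter> {1..N0 + 1})) / real (N0 + 1))"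
    by (rule assms) simp
  also have "{1..N0 + 1} = {1..<N0 + 2}"
    by auto
  finally have "l \<le> (case (1, N0 + 2) of (M, N) \<Rightarrow>
      ereal (real (card (A \<inter> {M..<N})) / (real N - real M)))"
    by (simp add: algebra_simps)
  also have "\<dots> \<le> (SUP x\<in>Collect P. case x of (M, N) \<Rightarrow>
      ereal (real (card (A \<inter> {M..<N})) / (real N - real M)))"
    by (rule SUP_upper) (use PN in simp)
  finally show "l \<le> \<dots>" .
qed

text \<open>An element is determined by its quotient and remainder. As \<open>q \<le> x\<close>
  excludes quotient 0, there are only \<open>n div q\<close> blocks to count; an extra block would
  add \<open>s\<close>, and with \<open>s = 2 ^ a\<close> these contributions would not be summable
  over \<open>a\<close>. This is why the sieve spares \<open>x < 2 ^ (2 * a + c)\<close>.\<close>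

lemma card_small_residues:
  fixes n q s :: nat
  assumes "q > 0"
  shows "card {x \<in> {1..n}. q \<le> x \<and> x mod q < s} \<le> (n div q) * s"
proof -
  have "card {x \<in> {1..n}. q \<le> x \<and> x mod q < s} \<le> card ({1..n div q} \<times> {..<s})"
  proof (rule card_inj_on_le)
    show "inj_on (\<lambda>x. (x div q, x mod q)) {x \<in> {1..n}. q \<le> x \<and> x mod q < s}"
      by (rule inj_onI) (metis div_mult_mod_eq prod.inject)
    show "(\<lambda>x. (x div q, x mod q)) ` {x \<in> {1..n}. q \<le> x \<and> x mod q < s}
        \<subseteq> {1..n div q} \<times> {..<s}"
      using assms by (auto simp: div_le_mono Suc_le_eq div_greater_zero_iff)
  qed simp
  then show ?thesis by simp
qed

lemma card_dyadic_sieve: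
  "real n * (1 - 2 / 2 ^ c) \<le> real (card (dyadic_sieve c \<inter> {1..n}))"
proof -
  define R where "R a = {x \<in> {1..n}. 2 ^ (2 * a + c) \<le> x \<and> x mod 2 ^ (2 * a + c) < 2 ^ a}" for a
  have R: "real (card (R a)) \<le> real n / 2 ^ c * (1 / 2) ^ a" for a
  proof -
    have "card (R a) \<le> (n div 2 ^ (2 * a + c)) * 2 ^ a"
      unfolding R_def by (rule card_small_residues) simp
    then have "real (card (R a)) \<le> real ((n div 2 ^ (2 * a + c)) * 2 ^ a)"
      by (simp only: of_nat_le_iff)
    also have "\<dots> = real (n div 2 ^ (2 * a + c)) * 2 ^ a"
      by simp
    also have "\<dots> \<le> real n / 2 ^ (2 * a + c) * 2 ^ a"
      using of_nat_div_le_of_nat[of n "2 ^ (2 * a + c)"] by (intro mult_right_mono) auto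
    also have "\<dots> = real n / 2 ^ c * (1 / 2) ^ a"
      by (simp add: power_add mult_2 power_divide)
    finally show ?thesis .
  qed
  \<comment> \<open>Finitely many \<open>a\<close> suffice, because a removed \<open>x\<close>
    satisfies \<open>a < 2 ^ (2 * a + c) \<le> x \<le> n\<close>.\<close>
  have sub: "{1..n} \<subseteq> (dyadic_sieve c \<inter> {1..n}) \<union> (\<Union>a<n. R a)"
  proof
    fix x assume x: "x \<in> {1..n}"
    show "x \<in> (dyadic_sieve c \<inter> {1..n}) \<union> (\<Union>a<n. R a)"
    proof (cases "x \<in> dyadic_sieve c")
      case False
      then obtain a where a: "2 ^ (2 * a + c) \<le> x" "x mod 2 ^ (2 * a + c) < 2 ^ a"
        using x by (auto simp: dyadic_sieve_def not_less not_le)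
      have "a < 2 ^ a" by (rule less_exp)
      also have "(2::nat) ^ a \<le> 2 ^ (2 * a + c)" by (rule power_increasing) auto
      finally have "a < n" using a(1) x by simp
      then show ?thesis using a x by (auto simp: R_def)
    qed (use x in simp)
  qed
  have "n = card {1..n}" by simp
  also have "\<dots> \<le> card ((dyadic_sieve c \<inter> {1..n}) \<union> (\<Union>a<n. R a))"
    by (rule card_mono[OF _ sub]) (auto simp: R_def)
  also have "\<dots> \<le> card (dyadic_sieve c \<inter> {1..n}) + (\<Sum>a<n. card (R a))"
    by (rule order.trans[OF card_Un_le]) (simp add: card_UN_le)
  finally have "real n \<le> real (card (dyadic_sieve c \<inter> {1..n})) + (\<Sum>a<n. real (card (R a)))"
    by (metis of_nat_add of_nat_le_iff of_nat_sum)
  moreover have "(\<Sum>a<n. real (card (R a))) \<le> real n * (2 / 2 ^ c)"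
  proof -
    have "(\<Sum>a<n. real (card (R a))) \<le> (\<Sum>a<n. real n / 2 ^ c * (1 / 2) ^ a)"
      by (intro sum_mono R)
    also have "\<dots> = real n / 2 ^ c * (2 - 2 * (1 / 2) ^ n)"
      unfolding sum_distrib_left[symmetric] by (simp add: sum_gp_strict algebra_simps)
    also have "\<dots> \<le> real n / 2 ^ c * 2"
      by (intro mult_left_mono) auto
    finally show ?thesis by simp
  qed
  ultimately show ?thesis by (simp add: algebra_simps)
qed

lemma upper_banach_density_dyadic_sieve:
  "ereal (1 - 2 / 2 ^ c) \<le> upper_banach_density (dyadic_sieve c)"
proof (rule le_upper_banach_density)
  fix n :: nat assume "n \<ge> 1"
  then show "ereal (1 - 2 / 2 ^ c) \<le> ereal (real (card (dyadic_sieve c \<inter> {1..n})) / real n)"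
    using card_dyadic_sieve[of n c] by (simp add: pos_le_divide_eq mult.commute)
qed

text \<open>Discarding the elements below \<open>L\<close> leaves \<open>C\<close> infinite, and a
  single remaining element makes the sum at least \<open>L\<close>. The size matters because the
  sieve removes small residues only from the modulus onwards.\<close>

lemma exists_large_sum_in_residue_class:
  fixes C :: "nat set"
  assumes "infinite C" and C: "\<And>n. n \<in> C \<Longrightarrow> [n = r] (mod m)" and "l \<ge> 1"
  obtains F where "finite F" "F \<subseteq> C" "card F = l" "L \<le> \<Sum>F" "[\<Sum>F = l * r] (mod m)"
proof -
  have "infinite (C - {..<L})"
    using assms(1) by simp
  then obtain F where F: "finite F" "card F = l" "F \<subseteq> C - {..<L}"
    using infinite_arbitrarily_large by blast
  then obtain x where x: "x \<in> F"
    using \<open>l \<ge> 1\<close> by fastforce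
  have "L \<le> x" using x F by auto
  also have "x \<le> \<Sum>F"
    using member_le_sum[of x F "\<lambda>x. x"] x F(1) by simp
  finally have "L \<le> \<Sum>F" .
  moreover have "[\<Sum>F = (\<Sum>n\<in>F. r)] (mod m)"
    by (rule cong_sum) (use F C in auto)
  ultimately show ?thesis
    using F that[of F] by auto
qed

text \<open>With \<open>l = k + x\<close> the congruence reads \<open>r * x = d\<close> modulo
  \<open>m\<close>. It is solvable because \<open>gcd r m\<close> divides both
  \<open>t mod gcd r m - t\<close> and \<open>k * r\<close>; reducing \<open>x\<close> modulo
  \<open>m\<close> keeps \<open>l\<close> within the window. Integers are used since
  \<open>d\<close> may be negative.\<close>

lemma exists_multiple_with_residue_below_gcd:
  fixes r t k m :: nat
  assumes "m > 0"
  obtains l where "k \<le> l" "l \<le> k + m" "[l * r + t = t mod gcd r m] (mod m)"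
proof -
  define d where "d = int (t mod gcd r m) - int t - int k * int r"
  have "int (gcd r m) dvd int (t mod gcd r m) - int t"
    by (simp add: zmod_int mod_eq_dvd_iff[symmetric])
  then have "gcd (int r) (int m) dvd d"
    unfolding d_def gcd_int_int_eq
    by (rule dvd_diff) (rule dvd_mult, simp)
  then obtain x where x: "[int r * x = d] (mod int m)"
    using cong_solve_dvd_int by blast
  define l where "l = k + nat (x mod int m)"
  have nn: "0 \<le> x mod int m" "x mod int m < int m"
    using assms by auto
  have "[x mod int m = x] (mod int m)"
    by (simp add: cong_def)
  then have "[int r * (x mod int m) = d] (mod int m)"
    using x cong_scalar_left cong_trans by blast
  then have "[int r * (x mod int m) + (int t + int k * int r) =
      d + (int t + int k * int r)] (mod int m)"
    by (rule cong_add) simp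
  moreover have "int r * (x mod int m) + (int t + int k * int r) = int (l * r + t)"
    using nn by (simp add: l_def algebra_simps)
  moreover have "d + (int t + int k * int r) = int (t mod gcd r m)"
    by (simp add: d_def)
  ultimately have "[l * r + t = t mod gcd r m] (mod m)"
    by (metis cong_int_iff)
  moreover have "k \<le> l" "l \<le> k + m"
    using nn by (auto simp: l_def)
  ultimately show ?thesis using that by blast
qed

lemma gcd_power_two_less:
  fixes r :: nat
  assumes "\<not> 2 ^ m dvd r"
  shows "gcd r (2 ^ b) < 2 ^ m"
proof -
  obtain j where j: "gcd r (2 ^ b) = 2 ^ j"
    using divides_primepow_nat[OF two_is_prime_nat, of "gcd r (2 ^ b)" b] by auto
  then have "2 ^ j dvd r"
    by (metis gcd_dvd1)
  then have "j < m"
    using assms by (metis dvd_trans le_imp_power_dvd not_less)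
  then show ?thesis
    by (simp add: j)
qed

lemma not_in_dyadic_sieve:
  assumes "2 ^ (2 * a + c) \<le> x" "[x = s] (mod 2 ^ (2 * a + c))" "s < 2 ^ a"
  shows "x \<notin> dyadic_sieve c"
proof -
  have "s < 2 ^ (2 * a + c)"
    by (rule less_le_trans[OF assms(3)]) (rule power_increasing, auto)
  then have "x mod 2 ^ (2 * a + c) = s"
    using assms(2) by (simp add: cong_def)
  then show ?thesis
    using assms by (auto simp: dyadic_sieve_def not_less not_le intro!: exI[of _ a])
qed

lemma dyadic_sieve_avoids_sums:
  fixes k t :: "nat \<Rightarrow> nat" and B :: "nat \<Rightarrow> nat set"
  assumes k: "\<And>i. i \<ge> 1 \<Longrightarrow> k i \<ge> 1"
    and inf: "\<And>i. i \<ge> 1 \<Longrightarrow> infinite (B i)"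
    and nested: "\<And>i. i \<ge> 1 \<Longrightarrow> B (i + 1) \<subseteq> B i"
  obtains i F where "i \<ge> 1" "finite F" "F \<subseteq> B i" "k i \<le> card F" "card F \<le> k i + i"
    "\<Sum>F + t i \<notin> dyadic_sieve c"
proof (cases "\<forall>m. infinite {n \<in> B 1. 2 ^ m dvd n}")
  case True
  \<comment> \<open>Here the sieve level is \<open>a = t 1\<close>, so that the residue
    \<open>t 1\<close> lies below \<open>2 ^ a\<close>.\<close>
  define q :: nat where "q = 2 ^ (2 * t 1 + c)"
  have "[n = 0] (mod q)" if "n \<in> {n \<in> B 1. q dvd n}" for n
    using that by (simp add: cong_0_iff)
  moreover have "infinite {n \<in> B 1. q dvd n}"
    using True by (simp add: q_def)
  ultimately obtain F where F: "finite F" "F \<subseteq> {n \<in> B 1. q dvd n}" "card F = k 1"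
      "q \<le> \<Sum>F" "[\<Sum>F = k 1 * 0] (mod q)"
    using exists_large_sum_in_residue_class[of "{n \<in> B 1. q dvd n}" 0 q "k 1" q] k[of 1] by auto
  have "[\<Sum>F + t 1 = 0 + t 1] (mod q)"
    using F(5) by (intro cong_add) auto
  then have "\<Sum>F + t 1 \<notin> dyadic_sieve c"
    using F(4) less_exp[of "t 1"] unfolding q_def by (intro not_in_dyadic_sieve) auto
  then show ?thesis
    using F that[of 1 F] by auto
next
  case False
  then obtain m where m: "finite {n \<in> B 1. 2 ^ m dvd n}" by blast
  \<comment> \<open>\<open>q\<close> serves as modulus and as index: at \<open>i = q\<close> the
    admissible cardinalities \<open>k q, ..., k q + q\<close> cover all residues modulo
    \<open>q\<close>.\<close>
  define q :: nat where "q = 2 ^ (2 * m + c)"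
  have q: "q \<ge> 1" by (simp add: q_def)
  have "B i \<subseteq> B 1" if "i \<ge> 1" for i
    using that by (induction rule: dec_induct) (use nested in auto)
  with q have "B q \<subseteq> B 1" by blast
  have "finite ((\<lambda>n. n mod q) ` B q)"
    by (rule finite_subset[of _ "{..<q}"]) (use q in auto)
  then obtain n0 where "infinite {n \<in> B q. n mod q = n0 mod q}"
    using pigeonhole_infinite[OF inf[OF q]] by blast
  then obtain r where r: "infinite {n \<in> B q. [n = r] (mod q)}"
    by (auto simp: cong_def)
  have "2 ^ m dvd q"
    unfolding q_def by (rule le_imp_power_dvd) simp
  \<comment> \<open>Otherwise, as \<open>2 ^ m\<close> divides \<open>q\<close>, the whole infinite
    class would consist of multiples of \<open>2 ^ m\<close> in \<open>B 1\<close>.\<close>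
  have "\<not> 2 ^ m dvd r"
  proof
    assume "2 ^ m dvd r"
    then have "{n \<in> B q. [n = r] (mod q)} \<subseteq> {n \<in> B 1. 2 ^ m dvd n}"
      using \<open>B q \<subseteq> B 1\<close> \<open>2 ^ m dvd q\<close> by (auto dest: cong_dvd_modulus_nat cong_dvd_iff)
    then show False
      using m r finite_subset by blast
  qed
  then have gcd: "gcd r q < 2 ^ m"
    unfolding q_def by (rule gcd_power_two_less)
  obtain l where l: "k q \<le> l" "l \<le> k q + q" "[l * r + t q = t q mod gcd r q] (mod q)"
    using exists_multiple_with_residue_below_gcd[of q "k q" r "t q"] q by auto
  obtain F where F: "finite F" "F \<subseteq> {n \<in> B q. [n = r] (mod q)}" "card F = l"
      "q \<le> \<Sum>F" "[\<Sum>F = l * r] (mod q)"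
    using exists_large_sum_in_residue_class[OF r, of r q l q] k[OF q] l(1) by auto
  have "[\<Sum>F + t q = l * r + t q] (mod q)"
    using F(5) by (intro cong_add) auto
  then have c: "[\<Sum>F + t q = t q mod gcd r q] (mod q)"
    using l(3) cong_trans by blast
  have "gcd r q > 0" using q by auto
  then have "t q mod gcd r q < 2 ^ m"
    using gcd by (meson less_trans mod_less_divisor)
  then have "\<Sum>F + t q \<notin> dyadic_sieve c"
    using F(4) c by (intro not_in_dyadic_sieve[where a = m]) (auto simp: q_def)
  then show ?thesis
    using F l q by (intro that[of q F]) auto
qed

theorem proposition2p2:
  fixes \<epsilon> :: real
  assumes "\<epsilon> > 0"
  shows "\<exists>A :: nat set. A \<subseteq> {1..} \<and> upper_banach_density A > ereal (1 - \<epsilon>) \<and>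
    (\<forall>(k :: nat \<Rightarrow> nat) (B :: nat \<Rightarrow> nat set) (t :: nat \<Rightarrow> nat).
       (\<forall>i\<ge>1. k i \<ge> 1) \<longrightarrow>
       (\<forall>i\<ge>1. B i \<subseteq> {1..} \<and> infinite (B i)) \<longrightarrow>
       (\<forall>i\<ge>1. B (i + 1) \<subseteq> B i) \<longrightarrow>
       (\<forall>i\<ge>1. t i \<ge> 1) \<longrightarrow>
       \<not> (\<forall>i\<ge>1. {\<Sum>n\<in>F. int n |F. finite F \<and> F \<subseteq> B i \<and> k i \<le> card F \<and> card F \<le> k i + i}
                  \<subseteq> shift A (int (t i))))"
proof -
  \<comment> \<open>The sieve loses density at most \<open>2 / 2 ^ c\<close>, which must be less
    than \<epsilon>.\<close>
  obtain c where c: "(1 / 2 :: real) ^ c < \<epsilon> / 2"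
    using real_arch_pow_inv[of "\<epsilon> / 2" "1 / 2"] assms by auto
  have "ereal (1 - \<epsilon>) < ereal (1 - 2 / 2 ^ c)"
    using c by (simp add: power_divide field_simps)
  also have "\<dots> \<le> upper_banach_density (dyadic_sieve c)"
    by (rule upper_banach_density_dyadic_sieve)
  finally have density: "ereal (1 - \<epsilon>) < upper_banach_density (dyadic_sieve c)" .
  show ?thesis
  proof (intro exI[of _ "dyadic_sieve c"] conjI allI impI notI)
    show "dyadic_sieve c \<subseteq> {1..}"
      by (auto simp: dyadic_sieve_def)
    show "ereal (1 - \<epsilon>) < upper_banach_density (dyadic_sieve c)"
      by (rule density)
  next
    fix k :: "nat \<Rightarrow> nat" and B :: "nat \<Rightarrow> nat set" and t :: "nat \<Rightarrow> nat"
    assume k: "\<forall>i\<ge>1. k i \<ge> 1"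
      and B: "\<forall>i\<ge>1. B i \<subseteq> {1..} \<and> infinite (B i)"
      and nested: "\<forall>i\<ge>1. B (i + 1) \<subseteq> B i"
      and sums: "\<forall>i\<ge>1. {\<Sum>n\<in>F. int n |F. finite F \<and> F \<subseteq> B i \<and> k i \<le> card F \<and>
          card F \<le> k i + i} \<subseteq> shift (dyadic_sieve c) (int (t i))"
    obtain i F where F: "i \<ge> 1" "finite F" "F \<subseteq> B i" "k i \<le> card F" "card F \<le> k i + i"
      "\<Sum>F + t i \<notin> dyadic_sieve c"
      using dyadic_sieve_avoids_sums[of k B t c] k B nested by blast
    then have "(\<Sum>n\<in>F. int n) \<in> shift (dyadic_sieve c) (int (t i))"
      using sums by blast
    then obtain a where "a \<in> dyadic_sieve c" "(\<Sum>n\<in>F. int n) = int a - int (t i)"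
      by (auto simp: shift_def)
    moreover from this have "int a = int (\<Sum>F + t i)"
      by simp
    ultimately show False
      using F(6) by (simp only: of_nat_eq_iff)
  qed
qed

end
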